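(* For $q\in(0,\infty)$ and $r\in(0,4]$ let $\Phi_{q,r}=\phi_q\circ f_r:[0,1]\to[0,1]$, where $\phi_q(x)=\frac{1-q^x}{1-q}$ (with $q=1$ corresponding to the undeformed case $\Phi_{1,r}=f_r$) and $f_r(x)=rx(1-x)$. Define $$\mathcal{S}_0=\left\{(q,r)\in(0,\infty)\times(0,4]:\ \frac{r\log(q)}{q-1}<1\right\}\cup\left\{(q,r)\in(0,\infty)\times(0,4]:\ r\log(q)=q-1\ \text{ and }\ q\le 3\right\}.$$ The fixed point $0$ of $\Phi_{q,r}$ is locally asymptotically stable (LAS) when $(q,r)\in\mathcal{S}_0$.
   Context: Let $I=[0,1]$, let $f:I\to I$ be continuous and let $f^n$ denote the $n$-th iterate of $f$. Neighborhoods are taken in $I$. A fixed point $x_0$ of $f$ is: - locally stable if for each $\varepsilon>0$ there is a neighborhood $V$ of $x_0$ such that $|f^n(x)-x_0|<\varepsilon$ for every $x\in V$ and every $n\in\mathbb{N}$; - attracting if there is a neighborhood $V$ of $x_0$ such that $\lim_{n\to\infty}f^n(x)=x_0$ for every $x\in V$; - locally asymptotically stable (LAS) if it is both locally stable and attracting. Here $\log$ is the natural logarithm.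
   Formalization: At q=1 the quotient log(q)/(q-1) is read as its limit 1, so (1,r) is in S_0 only for r≤1; literally, r log(q)=q-1 holds at q=1 for every r, and the claim fails there for r>1 (e.g. r=2). *)

theory Defs
  imports "HOL-Analysis.Analysis"
begin

abbreviation unitI :: "real set" where
  "unitI \<equiv> {0..1}"

definition nbhd_in_I :: "real \<Rightarrow> real set \<Rightarrow> bool" where
  "nbhd_in_I x0 V \<longleftrightarrow> V \<subseteq> unitI \<and> (\<exists>U. openin (top_of_set unitI) U \<and> x0 \<in> U \<and> U \<subseteq> V)"

(* Maps of the unit interval are total functions on the reals; only their values on unitI matter. *)

definition fixed_point :: "(real \<Rightarrow> real) \<Rightarrow> real \<Rightarrow> bool" where
  "fixed_point f x0 \<longleftrightarrow> x0 \<in> unitI \<and> f x0 = x0"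

definition locally_stable :: "(real \<Rightarrow> real) \<Rightarrow> real \<Rightarrow> bool" where
  "locally_stable f x0 \<longleftrightarrow>
     (\<forall>\<epsilon>>0. \<exists>V. nbhd_in_I x0 V \<and> (\<forall>x\<in>V. \<forall>n. \<bar>(f ^^ n) x - x0\<bar> < \<epsilon>))"

definition attracting :: "(real \<Rightarrow> real) \<Rightarrow> real \<Rightarrow> bool" where
  "attracting f x0 \<longleftrightarrow>
     (\<exists>V. nbhd_in_I x0 V \<and> (\<forall>x\<in>V. (\<lambda>n. (f ^^ n) x) \<longlonglongrightarrow> x0))"

definition LAS :: "(real \<Rightarrow> real) \<Rightarrow> real \<Rightarrow> bool" where
  "LAS f x0 \<longleftrightarrow> fixed_point f x0 \<and> locally_stable f x0 \<and> attracting f x0"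

definition phi :: "real \<Rightarrow> real \<Rightarrow> real" where
  "phi q x = (if q = 1 then x else (1 - q powr x) / (1 - q))"

definition logistic :: "real \<Rightarrow> real \<Rightarrow> real" where
  "logistic r x = r * x * (1 - x)"

definition Phi :: "real \<Rightarrow> real \<Rightarrow> real \<Rightarrow> real" where
  "Phi q r = phi q \<circ> logistic r"

(* log(q)/(q-1), with its limit value 1 in the undeformed case q = 1.  Without this convention
   the quotient would be 0/0 = 0 at q = 1, and r log(q) = q-1 would hold there for every r. *)
definition log_quot :: "real \<Rightarrow> real" where
  "log_quot q = (if q = 1 then 1 else ln q / (q - 1))"

definition S0 :: "(real \<times> real) set" where
  "S0 = {(q, r). q \<in> {0<..} \<and> r \<in> {0<..4} \<and> r * log_quot q < 1}
      \<union> {(q, r). q \<in> {0<..} \<and> r \<in> {0<..4} \<and> r * log_quot q = 1 \<and> q \<le> 3}"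

lemma S0_iff_deformed:
  assumes "q \<noteq> 1"
  shows "(q, r) \<in> S0 \<longleftrightarrow> q \<in> {0<..} \<and> r \<in> {0<..4} \<and>
           (r * ln q / (q - 1) < 1 \<or> r * ln q = q - 1 \<and> q \<le> 3)"
  using assms by (auto simp: S0_def log_quot_def)

lemma S0_iff_undeformed: "(1, r) \<in> S0 \<longleftrightarrow> 0 < r \<and> r \<le> 1"
  by (auto simp: S0_def log_quot_def)

lemma logistic_in_unitI:
  assumes "r \<in> {0<..4}" "x \<in> unitI"
  shows "logistic r x \<in> unitI"
proof -
  have x: "x * (1 - x) \<ge> 0" using assms by auto
  have "x * (1 - x) \<le> 1/4"
    using zero_le_power2[of "x - 1/2"] by (simp add: power2_eq_square algebra_simps)
  then have "r * (x * (1 - x)) \<le> 4 * (1/4)"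
    using assms x by (intro mult_mono) auto
  then show ?thesis using assms x by (simp add: logistic_def mult.assoc)
qed

lemma phi_in_unitI:
  assumes "q > 0" "x \<in> unitI"
  shows "phi q x \<in> unitI"
proof -
  consider "q = 1" | "q < 1" | "q > 1" by linarith
  then show ?thesis
  proof cases
    case 1 then show ?thesis using assms by (simp add: phi_def)
  next
    case 2
    have "q powr 1 \<le> q powr x" "q powr x \<le> q powr 0"
      using assms 2 powr_mono'[of x 1 q] powr_mono'[of 0 x q] by auto
    then show ?thesis using assms 2 by (simp add: phi_def divide_simps)
  next
    case 3
    have "q powr x \<le> q powr 1" "q powr 0 \<le> q powr x"
      using assms 3 powr_mono[of x 1 q] powr_mono[of 0 x q] by auto
    then show ?thesis using assms 3 by (simp add: phi_def divide_simps)
  qed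
qed

lemma Phi_maps_unitI: "q > 0 \<Longrightarrow> r \<in> {0<..4} \<Longrightarrow> Phi q r \<in> unitI \<rightarrow> unitI"
  using logistic_in_unitI phi_in_unitI by (simp add: Phi_def Pi_iff del: atLeastAtMost_iff)

lemma continuous_on_Phi: "q > 0 \<Longrightarrow> continuous_on unitI (Phi q r)"
  by (cases "q = 1") (auto simp: Phi_def phi_def logistic_def o_def intro!: continuous_intros)

end

(* Everything reduces to Phi q r x < x for all small x > 0: orbits then decrease to a fixed point,
   which can only be 0.  Put s = q - 1 and c = r ln q.  Taking logarithms, Phi q r x < x becomes
   c x (1 - x) < ln (1 + s x) for q > 1, and the reverse inequality for q < 1.  For q > 1 the bound
   u - u^2/2 < ln (1 + u) leaves the condition s^2 x / 2 \<le> (s - c) + c x, which holds for small x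
   if c < s, and for all x if c = s \<le> 2; this is where the condition q \<le> 3 originates.  For q < 1,
   ln (1 + s x) < s x \<le> c x suffices. *)

theory Submission
  imports Defs
begin

lemma nbhd_in_I_0:
  assumes "d > 0"
  shows "nbhd_in_I 0 (unitI \<inter> {..<d})"
proof -
  have "openin (top_of_set unitI) (unitI \<inter> {..<d})" by (intro openin_open_Int open_lessThan)
  moreover have "0 \<in> unitI \<inter> {..<d}" using assms by simp
  ultimately show ?thesis unfolding nbhd_in_I_def by blast
qed

text \<open>An orbit starting at \<open>x < d\<close> never leaves the interval from 0 to
  \<open>x\<close>, which gives stability. Being decreasing, it also converges, and continuity makes
  the limit a fixed point.\<close>

lemma LAS_0_if_below_id:
  fixes f :: "real \<Rightarrow> real"
  assumes cont: "continuous_on unitI f" and maps: "f \<in> unitI \<rightarrow> unitI" and f0: "f 0 = 0"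
    and d: "d > 0" and below: "\<And>x. x \<in> unitI \<Longrightarrow> 0 < x \<Longrightarrow> x < d \<Longrightarrow> f x < x"
  shows "LAS f 0"
proof -
  have le: "f x \<le> x" if "x \<in> unitI" "x < d" for x
    using below[of x] that f0 by (cases "x = 0") auto
  have orbit: "(f ^^ n) x \<in> unitI \<and> (f ^^ n) x \<le> x" if "x \<in> unitI" "x < d" for n x
  proof (induction n)
    case (Suc n)
    then show ?case using le[of "(f ^^ n) x"] funcset_mem[OF maps, of "(f ^^ n) x"] that by auto
  qed (use that in auto)
  have stable: "locally_stable f 0"
    unfolding locally_stable_def
  proof (intro allI impI)
    fix e :: real assume "e > 0"
    \<comment> \<open>Below \<open>d\<close> orbits never exceed their starting point, and starting
      below \<open>e\<close> then keeps them within \<open>e\<close> of 0.\<close>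
    then have "nbhd_in_I 0 (unitI \<inter> {..<min e d})" using d nbhd_in_I_0 by simp
    moreover have "\<bar>(f ^^ n) x - 0\<bar> < e" if "x \<in> unitI \<inter> {..<min e d}" for x n
      using orbit[of x n] that by auto
    ultimately show "\<exists>V. nbhd_in_I 0 V \<and> (\<forall>x\<in>V. \<forall>n. \<bar>(f ^^ n) x - 0\<bar> < e)" by blast
  qed
  have "(\<lambda>n. (f ^^ n) x) \<longlonglongrightarrow> 0" if x: "x \<in> unitI" "x < d" for x
  proof -
    have "decseq (\<lambda>n. (f ^^ n) x)"
      unfolding decseq_Suc_iff
    proof
      fix n show "(f ^^ Suc n) x \<le> (f ^^ n) x"
        using le[of "(f ^^ n) x"] orbit[OF x, of n] x by simp
    qed
    then obtain l where l: "(\<lambda>n. (f ^^ n) x) \<longlonglongrightarrow> l"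
      by (rule decseq_convergent[of _ 0]) (use orbit[OF x] in auto)
    have "0 \<le> l" by (rule LIMSEQ_le_const[OF l]) (use orbit[OF x] in auto)
    moreover have "l \<le> x" by (rule LIMSEQ_le_const2[OF l]) (use orbit[OF x] in auto)
    \<comment> \<open>The limit stays in the range where \<open>below\<close> applies, so a positive
      limit could not be fixed.\<close>
    ultimately have l_in: "l \<in> unitI" "l < d" using x by auto
    have "(\<lambda>n. f ((f ^^ n) x)) \<longlonglongrightarrow> f l"
      by (rule continuous_on_tendsto_compose[OF cont l l_in(1)]) (use orbit[OF x] in auto)
    moreover have "(\<lambda>n. f ((f ^^ n) x)) \<longlonglongrightarrow> l"
      using LIMSEQ_Suc[OF l] by simp
    ultimately have "f l = l" by (rule LIMSEQ_unique)
    then have "l = 0" using below[of l] l_in by force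
    then show ?thesis using l by simp
  qed
  then have "attracting f 0"
    unfolding attracting_def using nbhd_in_I_0[OF d] by blast
  then show ?thesis using stable f0 by (simp add: LAS_def fixed_point_def)
qed

text \<open>The difference of the two sides vanishes at 0 and has derivative t^2 / (1 + t) > 0 at
  each t > 0.\<close>

lemma ln_one_plus_gt_quadratic:
  fixes u :: real
  assumes "u > 0"
  shows "u - u\<^sup>2 / 2 < ln (1 + u)"
proof -
  let ?g = "\<lambda>t::real. ln (1 + t) - t + t\<^sup>2 / 2"
  have "?g 0 < ?g u"
  proof (rule DERIV_pos_imp_increasing_open[OF assms])
    fix t :: real assume "0 < t"
    then have "(?g has_real_derivative t\<^sup>2 / (1 + t)) (at t)"
      by (auto intro!: derivative_eq_intros simp: divide_simps power2_eq_square algebra_simps)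
    with \<open>0 < t\<close> show "\<exists>y. (?g has_real_derivative y) (at t) \<and> 0 < y" by force
  qed (auto intro!: continuous_intros)
  then show ?thesis by simp
qed

text \<open>Clearing the denominator leaves q^y < 1 + (q - 1) x, whose two sides are positive, so
  logarithms can be compared.\<close>

lemma phi_less_iff_gt1:
  assumes "q > 1" "x \<ge> 0"
  shows "phi q y < x \<longleftrightarrow> y * ln q < ln (1 + (q - 1) * x)"
proof -
  have "1 + (q - 1) * x > 0" using assms by (smt (verit) mult_nonneg_nonneg)
  then have "y * ln q < ln (1 + (q - 1) * x) \<longleftrightarrow> q powr y < 1 + (q - 1) * x"
    using assms ln_less_cancel_iff[of "q powr y" "1 + (q - 1) * x"] by simp
  then show ?thesis using assms by (simp add: phi_def divide_simps algebra_simps)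
qed

text \<open>Now the denominator 1 - q is positive, so the inequality between q^y and 1 + (q - 1) x
  is reversed. The bound x \<le> 1 keeps the argument of the logarithm at least q > 0.\<close>

lemma phi_less_iff_lt1:
  assumes "0 < q" "q < 1" "0 \<le> x" "x \<le> 1"
  shows "phi q y < x \<longleftrightarrow> ln (1 + (q - 1) * x) < y * ln q"
proof -
  have "(1 - q) * x \<le> (1 - q) * 1" using assms by (intro mult_left_mono) auto
  then have "1 + (q - 1) * x > 0" using assms by (simp add: algebra_simps)
  then have "ln (1 + (q - 1) * x) < y * ln q \<longleftrightarrow> 1 + (q - 1) * x < q powr y"
    using assms ln_less_cancel_iff[of "1 + (q - 1) * x" "q powr y"] by simp
  then show ?thesis using assms by (simp add: phi_def divide_simps algebra_simps)
qed

lemma Phi_below_id_near_0: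
  assumes "(q, r) \<in> S0"
  shows "\<exists>d>0. \<forall>x\<in>unitI. 0 < x \<longrightarrow> x < d \<longrightarrow> Phi q r x < x"
proof -
  have q: "q > 0" and r: "r > 0" using assms by (auto simp: S0_def)
  consider "q = 1" | "q < 1" | "q > 1" by linarith
  then show ?thesis
  proof cases
    case 1
    then have "r \<le> 1" using assms S0_iff_undeformed by simp
    have "Phi q r x < x" if "0 < x" "x < 1" for x
    proof -
      have "r * (x * (1 - x)) \<le> 1 * (x * (1 - x))"
        using \<open>r \<le> 1\<close> that by (intro mult_right_mono) auto
      also have "\<dots> < x" using that by (simp add: algebra_simps)
      finally show ?thesis using 1 by (simp add: Phi_def phi_def logistic_def mult.assoc)
    qed
    then show ?thesis by (intro exI[of _ 1]) auto
  next
    case 2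
    let ?s = "q - 1" and ?c = "r * ln q"
    \<comment> \<open>Both alternatives in \<open>S0\<close> give this: multiplying by the negative
      q - 1 turns the strict one into s < c.\<close>
    have c: "?s \<le> ?c" "?c < 0"
      using assms 2 q r by (auto simp: S0_iff_deformed divide_simps mult_pos_neg split: if_splits)
    have "Phi q r x < x" if x: "0 < x" "x < 1" for x
    proof -
      have "?s * 1 < ?s * x" using 2 x by (intro mult_strict_left_mono_neg) auto
      then have "?s * x > -1" using q by simp
      moreover have "?s * x < 0" using 2 x by (simp add: mult_neg_pos)
      \<comment> \<open>Strict because ln t = t - 1 only at t = 1.\<close>
      ultimately have "ln (1 + ?s * x) < ?s * x"
        using ln_add_one_self_le_self2[of "?s * x"] ln_eq_minus_one[of "1 + ?s * x"] by force
      also have "\<dots> \<le> ?c * x" using c x by (intro mult_right_mono) auto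
      also have "\<dots> \<le> ?c * (x * (1 - x))"
        using c x by (intro mult_left_mono_neg) (auto simp: algebra_simps)
      finally show ?thesis
        using phi_less_iff_lt1[OF q 2, of x "logistic r x"] x
        by (simp add: Phi_def logistic_def algebra_simps)
    qed
    then show ?thesis by (intro exI[of _ 1]) auto
  next
    case 3
    let ?s = "q - 1" and ?c = "r * ln q"
    have c: "?c > 0" using 3 r by simp
    have cases: "?c < ?s \<or> ?c = ?s \<and> ?s \<le> 2"
      using assms 3 by (auto simp: S0_iff_deformed divide_simps)
    obtain d where "d > 0" and d: "\<And>x. 0 < x \<Longrightarrow> x < d \<Longrightarrow> ?s\<^sup>2 * x / 2 \<le> (?s - ?c) + ?c * x"
    proof (cases "?c < ?s")
      case True
      show ?thesis
      proof (rule that)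
        \<comment> \<open>This radius solves s^2 x / 2 = s - c; the positive term c x is left as
          slack.\<close>
        show "2 * (?s - ?c) / ?s\<^sup>2 > 0" using True 3 by simp
        fix x assume x: "0 < x" "x < 2 * (?s - ?c) / ?s\<^sup>2"
        then have "?s\<^sup>2 * x / 2 < ?s - ?c" using 3 by (simp add: field_simps)
        then show "?s\<^sup>2 * x / 2 \<le> (?s - ?c) + ?c * x"
          using mult_pos_pos[OF c x(1)] by linarith
      qed
    next
      case False
      then have eq: "?c = ?s" "?s \<le> 2" using cases by auto
      \<comment> \<open>With c = s the condition reads s^2 x / 2 \<le> s x, that is s \<le> 2,
        whatever x > 0 is; the radius 1 is an arbitrary choice.\<close>
      show ?thesis
      proof (rule that[of 1])
        fix x :: real assume x: "0 < x"
        have "?s * (?s * x) \<le> 2 * (?s * x)" using eq 3 x by (intro mult_right_mono) auto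
        then show "?s\<^sup>2 * x / 2 \<le> (?s - ?c) + ?c * x"
          unfolding eq(1) by (simp add: power2_eq_square mult.assoc)
      qed simp
    qed
    have "Phi q r x < x" if x: "0 < x" "x < d" for x
    proof -
      \<comment> \<open>Multiplied by x and rearranged, the condition on \<open>d\<close> compares c
        x (1 - x) with the quadratic lower bound for the logarithm at u = s x.\<close>
      have "x * (?s\<^sup>2 * x / 2) \<le> x * ((?s - ?c) + ?c * x)"
        using d[OF x] x by (intro mult_left_mono) auto
      then have "?c * (x * (1 - x)) \<le> ?s * x - (?s * x)\<^sup>2 / 2"
        by (simp add: power2_eq_square algebra_simps)
      also have "\<dots> < ln (1 + ?s * x)"
        using 3 x by (intro ln_one_plus_gt_quadratic) auto
      finally show ?thesis
        using phi_less_iff_gt1[OF 3, of x "logistic r x"] x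
        by (simp add: Phi_def logistic_def algebra_simps)
    qed
    then show ?thesis using \<open>d > 0\<close> by blast
  qed
qed

theorem theorem4p1:
  fixes q r :: real
  assumes "(q, r) \<in> S0"
  shows "LAS (Phi q r) 0"
proof -
  have qr: "q > 0" "r \<in> {0<..4}" using assms by (auto simp: S0_def)
  obtain d where "d > 0" "\<And>x. x \<in> unitI \<Longrightarrow> 0 < x \<Longrightarrow> x < d \<Longrightarrow> Phi q r x < x"
    using Phi_below_id_near_0[OF assms] by blast
  moreover have "Phi q r 0 = 0" using qr by (simp add: Phi_def phi_def logistic_def)
  ultimately show ?thesis
    using LAS_0_if_below_id[OF continuous_on_Phi Phi_maps_unitI] qr by blast
qed

end
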